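(* Let $\varepsilon,\mu>0$, $\lambda\in\mathbb{R}$, $\tau,h_x,h_y,h_z>0$ be constants and let $I,J,K\ge 3$ be integers such that the periodic tridiagonal matrices $A_I,A_J,A_K$ (defined in the context) are invertible. Let $({\bf E}^n,{\bf H}^n)_{n\ge 0}$ be random real grid functions generated by Splitting method II, i.e. for every $n\ge 0$ there are grid functions ${\bf E}^{[1]},{\bf H}^{[1]},{\bf E}^{[2]},{\bf H}^{[2]},{\bf E}^{[3]},{\bf H}^{[3]}$ (depending on $n$) such that, for all $0\le i\le I-1$, $0\le j\le J-1$, $0\le k\le K-1$, the following four stages hold. Stage 1: $E_1^{[1]}=E_1^{n}$, $H_1^{[1]}=H_1^{n}$, and $$\begin{pmatrix}\varepsilon (E_2^{[1]}-E_2^{n})_{\cdot,j,k}\\ \mu (H_3^{[1]}-H_3^{n})_{\cdot,j,k}\end{pmatrix}=-\frac{\tau}{h_x}\mathcal{A}_I^{-1}\mathcal{B}_I\begin{pmatrix}\tfrac12(E_2^{[1]}+E_2^{n})_{\cdot,j,k}\\ \tfrac12(H_3^{[1]}+H_3^{n})_{\cdot,j,k}\end{pmatrix},$$ $$\begin{pmatrix}\varepsilon (E_3^{[1]}-E_3^{n})_{\cdot,j,k}\\ \mu (H_2^{[1]}-H_2^{n})_{\cdot,j,k}\end{pmatrix}=\frac{\tau}{h_x}\mathcal{A}_I^{-1}\mathcal{B}_I\begin{pmatrix}\tfrac12(E_3^{[1]}+E_3^{n})_{\cdot,j,k}\\ \tfrac12(H_2^{[1]}+H_2^{n})_{\cdot,j,k}\end{pmatrix}.$$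 Stage 2: $E_2^{[2]}=E_2^{[1]}$, $H_2^{[2]}=H_2^{[1]}$, and $$\begin{pmatrix}\varepsilon (E_3^{[2]}-E_3^{[1]})_{i,\cdot,k}\\ \mu (H_1^{[2]}-H_1^{[1]})_{i,\cdot,k}\end{pmatrix}=-\frac{\tau}{h_y}\mathcal{A}_J^{-1}\mathcal{B}_J\begin{pmatrix}\tfrac12(E_3^{[2]}+E_3^{[1]})_{i,\cdot,k}\\ \tfrac12(H_1^{[2]}+H_1^{[1]})_{i,\cdot,k}\end{pmatrix},$$ $$\begin{pmatrix}\varepsilon (E_1^{[2]}-E_1^{[1]})_{i,\cdot,k}\\ \mu (H_3^{[2]}-H_3^{[1]})_{i,\cdot,k}\end{pmatrix}=\frac{\tau}{h_y}\mathcal{A}_J^{-1}\mathcal{B}_J\begin{pmatrix}\tfrac12(E_1^{[2]}+E_1^{[1]})_{i,\cdot,k}\\ \tfrac12(H_3^{[2]}+H_3^{[1]})_{i,\cdot,k}\end{pmatrix}.$$ Stage 3: $E_3^{[3]}=E_3^{[2]}$, $H_3^{[3]}=H_3^{[2]}$, and $$\begin{pmatrix}\varepsilon (E_1^{[3]}-E_1^{[2]})_{i,j,\cdot}\\ \mu (H_2^{[3]}-H_2^{[2]})_{i,j,\cdot}\end{pmatrix}=-\frac{\tau}{h_z}\mathcal{A}_K^{-1}\mathcal{B}_K\begin{pmatrix}\tfrac12(E_1^{[3]}+E_1^{[2]})_{i,j,\cdot}\\ \tfrac12(H_2^{[3]}+H_2^{[2]})_{i,j,\cdot}\end{pmatrix},$$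 $$\begin{pmatrix}\varepsilon (E_2^{[3]}-E_2^{[2]})_{i,j,\cdot}\\ \mu (H_1^{[3]}-H_1^{[2]})_{i,j,\cdot}\end{pmatrix}=\frac{\tau}{h_z}\mathcal{A}_K^{-1}\mathcal{B}_K\begin{pmatrix}\tfrac12(E_2^{[3]}+E_2^{[2]})_{i,j,\cdot}\\ \tfrac12(H_1^{[3]}+H_1^{[2]})_{i,j,\cdot}\end{pmatrix}.$$ Stage 4: $$\begin{pmatrix}{\bf E}^{n+1}_{i,j,k}\\ {\bf H}^{n+1}_{i,j,k}\end{pmatrix}=S\big((\Delta W)^n_{i,j,k}\big)\begin{pmatrix}{\bf E}^{[3]}_{i,j,k}\\ {\bf H}^{[3]}_{i,j,k}\end{pmatrix}.$$ Then for every $n\ge 0$, $$\varepsilon\|{\bf E}^{n+1}\|^2+\mu\|{\bf H}^{n+1}\|^2=\varepsilon\|{\bf E}^{n}\|^2+\mu\|{\bf H}^{n}\|^2\qquad \mathbb{P}\text{-almost surely}.$$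
   Context: The scheme discretizes the stochastic Maxwell equations $\varepsilon\,{\rm d}{\bf E}={\bf curl}\,{\bf H}\,{\rm d}t-\lambda{\bf H}\circ{\rm d}W$, $\mu\,{\rm d}{\bf H}=-{\bf curl}\,{\bf E}\,{\rm d}t+\lambda{\bf E}\circ{\rm d}W$ (Stratonovich) on a cuboid, with mesh sizes $h_x,h_y,h_z$ and time step $\tau$. Grid functions: real arrays $u=(u_{i,j,k})$ with $0\le i\le I-1$, $0\le j\le J-1$, $0\le k\le K-1$. Each of ${\bf E}=(E_1,E_2,E_3)$ and ${\bf H}=(H_1,H_2,H_3)$ is a triple of grid functions, and ${\bf E}_{i,j,k}=(E_1,E_2,E_3)^\top_{i,j,k}\in\mathbb{R}^3$ (likewise ${\bf H}_{i,j,k}$). Line vectors: $u_{\cdot,j,k}=(u_{0,j,k},\dots,u_{I-1,j,k})^\top\in\mathbb{R}^I$, $u_{i,\cdot,k}=(u_{i,0,k},\dots,u_{i,J-1,k})^\top\in\mathbb{R}^J$, $u_{i,j,\cdot}=(u_{i,j,0},\dots,u_{i,j,K-1})^\top\in\mathbb{R}^K$. Matrices: for $m\ge 3$, with indices modulo $m$, $A_m\in\mathbb{R}^{m\times m}$ is the symmetric circulant matrix with $(A_m v)_r=\tfrac12(v_{r-1}+2v_r+v_{r+1})$, and $B_m\in\mathbb{R}^{m\times m}$ is the circulant matrix with $(B_m v)_r=v_{r+1}-v_{r-1}$. Put $$\mathcal{A}_m=\begin{pmatrix} A_m & 0 \\ 0 & A_m \end{pmatrix},\qquad \mathcal{B}_m=\begin{pmatrix}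 0 & B_m \\ B_m & 0 \end{pmatrix}\in\mathbb{R}^{2m\times 2m}.$$ Stochastic flow: for $t\in\mathbb{R}$, $S(t)\in\mathbb{R}^{6\times 6}$ is $$S(t)=\exp\left(t\begin{pmatrix}0&-\lambda\varepsilon^{-1}I_{3\times3}\\ \lambda\mu^{-1}I_{3\times3}&0\end{pmatrix}\right)=\begin{pmatrix}\cos(\theta t)I_{3\times3}&-\varepsilon^{-1/2}\mu^{1/2}\sin(\theta t)I_{3\times3}\\ \varepsilon^{1/2}\mu^{-1/2}\sin(\theta t)I_{3\times3}&\cos(\theta t)I_{3\times3}\end{pmatrix},\quad \theta=\lambda(\varepsilon\mu)^{-1/2}.$$ Noise: on a probability space $(\Omega,\mathcal{F},\mathbb{P})$, $(\Delta W)^n_{i,j,k}=W^{n+1}_{i,j,k}-W^n_{i,j,k}$ is the real-valued random variable giving the increment over $[n\tau,(n+1)\tau]$ of the driving real-valued ($Q$-Wiener) noise at the grid point $(i,j,k)$. Norms: $\|u\|_{l^2}^2=h_xh_yh_z\sum_{i=0}^{I-1}\sum_{j=0}^{J-1}\sum_{k=0}^{K-1}|u_{i,j,k}|^2$ for a grid function $u$, and $\|{\bf f}\|^2=\|f_1\|_{l^2}^2+\|f_2\|_{l^2}^2+\|f_3\|_{l^2}^2$ for ${\bf f}=(f_1,f_2,f_3)$. *)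

theory Defs
  imports "HOL-Probability.Probability" "Jordan_Normal_Form.Gauss_Jordan_Elimination"
begin

(* From here on, $ is the component of a vector of Jordan_Normal_Form. *)
unbundle no vec_syntax

(* Grid functions are total functions on nat indices; every condition and every sum below is
   restricted to the index ranges i < I, j < J, k < K. *)
type_synonym grid_fun = "nat \<Rightarrow> nat \<Rightarrow> nat \<Rightarrow> real"

(* Components are indexed by the type 3 as for vectors in real ^ 3: E 1, E 2, E 3
   (the numeral 3 denotes the same element of that type as 0). *)
type_synonym grid_field = "3 \<Rightarrow> grid_fun"


definition circ_A :: "nat \<Rightarrow> real mat" where
  "circ_A m = mat m m (\<lambda>(r, c). 1/2 * (of_bool (c = (r + m - 1) mod m)
      + 2 * of_bool (c = r) + of_bool (c = (r + 1) mod m)))"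

definition circ_B :: "nat \<Rightarrow> real mat" where
  "circ_B m = mat m m (\<lambda>(r, c). of_bool (c = (r + 1) mod m) - of_bool (c = (r + m - 1) mod m))"

definition block_A :: "nat \<Rightarrow> real mat" where
  "block_A m = four_block_mat (circ_A m) (0\<^sub>m m m) (0\<^sub>m m m) (circ_A m)"

definition block_B :: "nat \<Rightarrow> real mat" where
  "block_B m = four_block_mat (0\<^sub>m m m) (circ_B m) (circ_B m) (0\<^sub>m m m)"

(* mat_inverse is option-valued; the result is the inverse only for invertible arguments. *)
definition mat_inv :: "real mat \<Rightarrow> real mat" where
  "mat_inv M = the (mat_inverse M)"

lemma circ_A_mult_vec:
  assumes v: "v \<in> carrier_vec m" and r: "r < m"
  shows "(circ_A m *\<^sub>v v) $ r = 1/2 * (v $ ((r + m - 1) mod m) + 2 * v $ r + v $ ((r + 1) mod m))"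
proof -
  have "(circ_A m *\<^sub>v v) $ r = (\<Sum>c = 0..<m. 1/2 * ((if c = (r + m - 1) mod m then v $ c else 0)
      + 2 * (if c = r then v $ c else 0) + (if c = (r + 1) mod m then v $ c else 0)))"
    using v r by (auto simp: circ_A_def scalar_prod_def intro!: sum.cong)
  also have "\<dots> = 1/2 * ((\<Sum>c = 0..<m. if c = (r + m - 1) mod m then v $ c else 0)
      + 2 * (\<Sum>c = 0..<m. if c = r then v $ c else 0)
      + (\<Sum>c = 0..<m. if c = (r + 1) mod m then v $ c else 0))"
    by (simp only: sum_distrib_left[symmetric] sum.distrib)
  finally show ?thesis using r by simp
qed

lemma circ_B_mult_vec:
  assumes v: "v \<in> carrier_vec m" and r: "r < m"
  shows "(circ_B m *\<^sub>v v) $ r = v $ ((r + 1) mod m) - v $ ((r + m - 1) mod m)"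
proof -
  have "(circ_B m *\<^sub>v v) $ r = (\<Sum>c = 0..<m. (if c = (r + 1) mod m then v $ c else 0)
      - (if c = (r + m - 1) mod m then v $ c else 0))"
    using v r by (auto simp: circ_B_def scalar_prod_def intro!: sum.cong)
  also have "\<dots> = (\<Sum>c = 0..<m. if c = (r + 1) mod m then v $ c else 0)
      - (\<Sum>c = 0..<m. if c = (r + m - 1) mod m then v $ c else 0)"
    by (simp only: sum_subtractf)
  finally show ?thesis using r by simp
qed


definition mat_exp :: "real mat \<Rightarrow> real mat" where
  "mat_exp A = mat (dim_row A) (dim_col A) (\<lambda>(r, c). \<Sum>n. (A ^\<^sub>m n) $$ (r, c) / fact n)"

definition stoch_flow :: "real \<Rightarrow> real \<Rightarrow> real \<Rightarrow> real \<Rightarrow> real mat" where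
  "stoch_flow \<epsilon> \<mu> lam t = mat_exp (t \<cdot>\<^sub>m
     four_block_mat (0\<^sub>m 3 3) ((- (lam / \<epsilon>)) \<cdot>\<^sub>m 1\<^sub>m 3) ((lam / \<mu>) \<cdot>\<^sub>m 1\<^sub>m 3) (0\<^sub>m 3 3))"

lemma stoch_flow_closed_form:
  fixes \<epsilon> \<mu> lam t :: real
  assumes pos: "\<epsilon> > 0" "\<mu> > 0"
  defines "th \<equiv> lam / sqrt (\<epsilon> * \<mu>)"
  shows "stoch_flow \<epsilon> \<mu> lam t = four_block_mat
    (cos (th * t) \<cdot>\<^sub>m 1\<^sub>m 3) ((- (sqrt \<mu> / sqrt \<epsilon> * sin (th * t))) \<cdot>\<^sub>m 1\<^sub>m 3)
    ((sqrt \<epsilon> / sqrt \<mu> * sin (th * t)) \<cdot>\<^sub>m 1\<^sub>m 3) (cos (th * t) \<cdot>\<^sub>m 1\<^sub>m 3)"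
proof -
  define bl :: "real \<Rightarrow> real \<Rightarrow> real \<Rightarrow> real \<Rightarrow> real mat" where
    "bl a b c d = four_block_mat (a \<cdot>\<^sub>m 1\<^sub>m 3) (b \<cdot>\<^sub>m 1\<^sub>m 3) (c \<cdot>\<^sub>m 1\<^sub>m 3) (d \<cdot>\<^sub>m 1\<^sub>m 3)" for a b c d
  define x where "x = th * t"
  define p where "p = sqrt \<mu> / sqrt \<epsilon>"
  define q where "q = sqrt \<epsilon> / sqrt \<mu>"
  have pq: "p * q = 1" using pos by (simp add: p_def q_def)
  have px: "p * x = t * (lam / \<epsilon>)"
    using pos by (simp add: p_def x_def th_def real_sqrt_mult field_simps flip: power2_eq_square)
  have qx: "q * x = t * (lam / \<mu>)"
    using pos by (simp add: q_def x_def th_def real_sqrt_mult field_simps flip: power2_eq_square)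
  define N where "N = bl 0 (- (p * x)) (q * x) 0"
  have N: "t \<cdot>\<^sub>m four_block_mat (0\<^sub>m 3 3) ((- (lam / \<epsilon>)) \<cdot>\<^sub>m 1\<^sub>m 3) ((lam / \<mu>) \<cdot>\<^sub>m 1\<^sub>m 3) (0\<^sub>m 3 3) = N"
    unfolding N_def bl_def px qx by (rule eq_matI) auto
  have bl_mult: "bl a b c d * bl a' b' c' d' =
      bl (a * a' + b * c') (a * b' + b * d') (c * a' + d * c') (c * b' + d * d')" for a b c d a' b' c' d'
  proof -
    have sc: "(u \<cdot>\<^sub>m 1\<^sub>m 3) * (w \<cdot>\<^sub>m 1\<^sub>m 3) = (u * w) \<cdot>\<^sub>m (1\<^sub>m 3 :: real mat)" for u w :: real
      by (subst mult_smult_assoc_mat[of _ 3 3 _ 3]) (auto intro!: eq_matI)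
    have ad: "(u \<cdot>\<^sub>m 1\<^sub>m 3) + (w \<cdot>\<^sub>m 1\<^sub>m 3) = (u + w) \<cdot>\<^sub>m (1\<^sub>m 3 :: real mat)" for u w :: real
      by (auto intro!: eq_matI)
    show ?thesis unfolding bl_def
      by (subst mult_four_block_mat[of _ 3 3 _ 3 _ 3 _ _ 3 _ 3]) (auto simp: sc ad)
  qed
  have bl_index: "bl a b c d $$ (r, s) =
      (if r < 3 then (if s < 3 then a * of_bool (r = s) else b * of_bool (r = s - 3))
       else (if s < 3 then c * of_bool (r - 3 = s) else d * of_bool (r = s)))"
    if "r < 6" "s < 6" for a b c d r s
    using that by (auto simp: bl_def)
  define C where "C n = cos_coeff n * fact n * x ^ n" for n
  define S where "S n = sin_coeff n * fact n * x ^ n" for n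
  have C_Suc: "C (Suc n) = - (S n * x)" for n
    by (simp add: C_def S_def cos_coeff_Suc del: of_nat_Suc)
  have S_Suc: "S (Suc n) = C n * x" for n
    by (simp add: C_def S_def sin_coeff_Suc del: of_nat_Suc)
  have pow: "N ^\<^sub>m n = bl (C n) (- (p * S n)) (q * S n) (C n)" for n
  proof (induction n)
    case 0
    show ?case by (rule eq_matI) (auto simp: N_def bl_def C_def S_def)
  next
    case (Suc n)
    have e: "p * (q * w) = w" for w
      using pq by (simp flip: mult.assoc)
    have "N ^\<^sub>m Suc n = bl (C n) (- (p * S n)) (q * S n) (C n) * bl 0 (- (p * x)) (q * x) 0"
      by (simp add: Suc.IH) (simp add: N_def)
    also have "\<dots> = bl (- (S n * x)) (- (p * (C n * x))) (q * (C n * x)) (- (S n * x))"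
      unfolding bl_mult by (simp add: mult_ac e)
    finally show ?case unfolding C_Suc S_Suc .
  qed
  have "(\<lambda>n. cos_coeff n * x ^ n) sums cos x" "(\<lambda>n. sin_coeff n * x ^ n) sums sin x"
    using cos_converges[of x] sin_converges[of x] by simp_all
  then have sC: "(\<lambda>n. C n / fact n) sums cos x" and sS: "(\<lambda>n. S n / fact n) sums sin x"
    by (simp_all add: C_def S_def)
  have "(\<lambda>n. (N ^\<^sub>m n) $$ (r, s) / fact n) sums (bl (cos x) (- (p * sin x)) (q * sin x) (cos x) $$ (r, s))"
    if rs: "r < 6" "s < 6" for r s
    unfolding pow bl_index[OF rs]
    using sC sums_minus[OF sums_mult[OF sS, of p]] sums_mult[OF sS, of q]
    by auto
  then have "mat_exp N = bl (cos x) (- (p * sin x)) (q * sin x) (cos x)"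
    unfolding mat_exp_def
    by (intro eq_matI) (auto simp: N_def bl_def sums_iff simp del: index_mat_four_block(1))
  then show ?thesis
    unfolding stoch_flow_def N by (simp add: bl_def x_def p_def q_def)
qed


(* One implicit midpoint step along a grid line of length m:
   (\<epsilon> (u' - u), \<mu> (v' - v)) = c A^(-1) B ((u' + u) / 2, (v' + v) / 2). *)
definition line_step ::
  "real \<Rightarrow> real \<Rightarrow> nat \<Rightarrow> real \<Rightarrow> (nat \<Rightarrow> real) \<Rightarrow> (nat \<Rightarrow> real) \<Rightarrow> (nat \<Rightarrow> real) \<Rightarrow> (nat \<Rightarrow> real) \<Rightarrow> bool" where
  "line_step \<epsilon> \<mu> m c u u' v v' \<longleftrightarrow>
     vec m (\<lambda>r. \<epsilon> * (u' r - u r)) @\<^sub>v vec m (\<lambda>r. \<mu> * (v' r - v r))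
     = c \<cdot>\<^sub>v ((mat_inv (block_A m) * block_B m) *\<^sub>v
         (vec m (\<lambda>r. (u' r + u r) / 2) @\<^sub>v vec m (\<lambda>r. (v' r + v r) / 2)))"

definition stage1 where
  "stage1 \<epsilon> \<mu> \<tau> hx I J K (E :: grid_field) (H :: grid_field) (E' :: grid_field) (H' :: grid_field) \<longleftrightarrow>
     (\<forall>i<I. \<forall>j<J. \<forall>k<K. E' 1 i j k = E 1 i j k \<and> H' 1 i j k = H 1 i j k) \<and>
     (\<forall>j<J. \<forall>k<K.
        line_step \<epsilon> \<mu> I (- (\<tau> / hx)) (\<lambda>i. E 2 i j k) (\<lambda>i. E' 2 i j k) (\<lambda>i. H 3 i j k) (\<lambda>i. H' 3 i j k) \<and>
        line_step \<epsilon> \<mu> I (\<tau> / hx) (\<lambda>i. E 3 i j k) (\<lambda>i. E' 3 i j k) (\<lambda>i. H 2 i j k) (\<lambda>i. H' 2 i j k))"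

definition stage2 where
  "stage2 \<epsilon> \<mu> \<tau> hy I J K (E :: grid_field) (H :: grid_field) (E' :: grid_field) (H' :: grid_field) \<longleftrightarrow>
     (\<forall>i<I. \<forall>j<J. \<forall>k<K. E' 2 i j k = E 2 i j k \<and> H' 2 i j k = H 2 i j k) \<and>
     (\<forall>i<I. \<forall>k<K.
        line_step \<epsilon> \<mu> J (- (\<tau> / hy)) (\<lambda>j. E 3 i j k) (\<lambda>j. E' 3 i j k) (\<lambda>j. H 1 i j k) (\<lambda>j. H' 1 i j k) \<and>
        line_step \<epsilon> \<mu> J (\<tau> / hy) (\<lambda>j. E 1 i j k) (\<lambda>j. E' 1 i j k) (\<lambda>j. H 3 i j k) (\<lambda>j. H' 3 i j k))"

definition stage3 where
  "stage3 \<epsilon> \<mu> \<tau> hz I J K (E :: grid_field) (H :: grid_field) (E' :: grid_field) (H' :: grid_field) \<longleftrightarrow>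
     (\<forall>i<I. \<forall>j<J. \<forall>k<K. E' 3 i j k = E 3 i j k \<and> H' 3 i j k = H 3 i j k) \<and>
     (\<forall>i<I. \<forall>j<J.
        line_step \<epsilon> \<mu> K (- (\<tau> / hz)) (\<lambda>k. E 1 i j k) (\<lambda>k. E' 1 i j k) (\<lambda>k. H 2 i j k) (\<lambda>k. H' 2 i j k) \<and>
        line_step \<epsilon> \<mu> K (\<tau> / hz) (\<lambda>k. E 2 i j k) (\<lambda>k. E' 2 i j k) (\<lambda>k. H 1 i j k) (\<lambda>k. H' 1 i j k))"

definition point_vec :: "grid_field \<Rightarrow> grid_field \<Rightarrow> nat \<Rightarrow> nat \<Rightarrow> nat \<Rightarrow> real vec" where
  "point_vec E H i j k = vec_of_list [E 1 i j k, E 2 i j k, E 3 i j k] @\<^sub>v vec_of_list [H 1 i j k, H 2 i j k, H 3 i j k]"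

definition stage4 where
  "stage4 \<epsilon> \<mu> lam I J K (dW :: grid_fun) (E :: grid_field) (H :: grid_field) (E' :: grid_field) (H' :: grid_field) \<longleftrightarrow>
     (\<forall>i<I. \<forall>j<J. \<forall>k<K. point_vec E' H' i j k = stoch_flow \<epsilon> \<mu> lam (dW i j k) *\<^sub>v point_vec E H i j k)"

definition splitting_step where
  "splitting_step \<epsilon> \<mu> lam \<tau> hx hy hz I J K dW E H E' H' \<longleftrightarrow>
     (\<exists>E1 H1 E2 H2 E3 H3.
        stage1 \<epsilon> \<mu> \<tau> hx I J K E H E1 H1 \<and>
        stage2 \<epsilon> \<mu> \<tau> hy I J K E1 H1 E2 H2 \<and>
        stage3 \<epsilon> \<mu> \<tau> hz I J K E2 H2 E3 H3 \<and>
        stage4 \<epsilon> \<mu> lam I J K dW E3 H3 E' H')"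


(* The centred Gaussian law on the reals with variance v \<ge> 0, including the degenerate case. *)
definition centred_normal :: "real \<Rightarrow> real measure" where
  "centred_normal v = (if v = 0 then return borel 0 else density lborel (normal_density 0 (sqrt v)))"

(* The Q-Wiener process with values in the functions on a finite set G and with covariance
   operator given by the matrix Q: the increment over [s, t] has law N(0, (t - s) Q), expressed
   through its linear functionals. *)
definition Q_wiener :: "'w measure \<Rightarrow> 'p set \<Rightarrow> ('p \<Rightarrow> 'p \<Rightarrow> real) \<Rightarrow> (real \<Rightarrow> 'p \<Rightarrow> 'w \<Rightarrow> real) \<Rightarrow> bool" where
  "Q_wiener M G Q W \<longleftrightarrow>
     (\<forall>x\<in>G. \<forall>y\<in>G. Q x y = Q y x) \<and>
     (\<forall>a. 0 \<le> (\<Sum>x\<in>G. \<Sum>y\<in>G. a x * Q x y * a y)) \<and>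
     (\<forall>t\<ge>0. \<forall>x\<in>G. W t x \<in> borel_measurable M) \<and>
     (\<forall>x\<in>G. AE \<omega> in M. W 0 x \<omega> = 0) \<and>
     (\<forall>x\<in>G. AE \<omega> in M. continuous_on {0..} (\<lambda>t. W t x \<omega>)) \<and>
     (\<forall>t :: nat \<Rightarrow> real. 0 \<le> t 0 \<longrightarrow> mono t \<longrightarrow>
        prob_space.indep_vars M (\<lambda>_. Pi\<^sub>M G (\<lambda>_. borel))
          (\<lambda>l \<omega>. \<lambda>x\<in>G. W (t (Suc l)) x \<omega> - W (t l) x \<omega>) UNIV) \<and>
     (\<forall>s t a. 0 \<le> s \<longrightarrow> s \<le> t \<longrightarrow>
        distr M borel (\<lambda>\<omega>. \<Sum>x\<in>G. a x * (W t x \<omega> - W s x \<omega>)) =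
        centred_normal ((t - s) * (\<Sum>x\<in>G. \<Sum>y\<in>G. a x * Q x y * a y)))"

definition grid :: "nat \<Rightarrow> nat \<Rightarrow> nat \<Rightarrow> (nat \<times> nat \<times> nat) set" where
  "grid I J K = {..<I} \<times> {..<J} \<times> {..<K}"

definition noise_increment :: "real \<Rightarrow> (real \<Rightarrow> nat \<times> nat \<times> nat \<Rightarrow> 'w \<Rightarrow> real) \<Rightarrow> nat \<Rightarrow> 'w \<Rightarrow> grid_fun" where
  "noise_increment \<tau> W n \<omega> i j k = W (real (n + 1) * \<tau>) (i, j, k) \<omega> - W (real n * \<tau>) (i, j, k) \<omega>"

definition random_grid_field :: "'w measure \<Rightarrow> nat \<Rightarrow> nat \<Rightarrow> nat \<Rightarrow> ('w \<Rightarrow> grid_field) \<Rightarrow> bool" where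
  "random_grid_field M I J K F \<longleftrightarrow>
     (\<forall>c. \<forall>i<I. \<forall>j<J. \<forall>k<K. (\<lambda>\<omega>. F \<omega> c i j k) \<in> borel_measurable M)"


definition l2_norm :: "real \<Rightarrow> real \<Rightarrow> real \<Rightarrow> nat \<Rightarrow> nat \<Rightarrow> nat \<Rightarrow> grid_fun \<Rightarrow> real" where
  "l2_norm hx hy hz I J K u = sqrt (hx * hy * hz * (\<Sum>i<I. \<Sum>j<J. \<Sum>k<K. \<bar>u i j k\<bar>\<^sup>2))"

definition field_norm :: "real \<Rightarrow> real \<Rightarrow> real \<Rightarrow> nat \<Rightarrow> nat \<Rightarrow> nat \<Rightarrow> grid_field \<Rightarrow> real" where
  "field_norm hx hy hz I J K f = sqrt ((l2_norm hx hy hz I J K (f 1))\<^sup>2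
     + (l2_norm hx hy hz I J K (f 2))\<^sup>2 + (l2_norm hx hy hz I J K (f 3))\<^sup>2)"

end

theory Submission
  imports Defs
begin

text \<open>
  Each of the first three stages acts on grid lines as an implicit midpoint step with generator
  \<open>c \<cdot> A\<^sup>-\<^sup>1 B\<close>, so the energy changes by \<open>2 c \<cdot> \<langle>w, A\<^sup>-\<^sup>1 B w\<rangle>\<close>, where \<open>w\<close> is the midpoint.
  Writing \<open>w = A y\<close> and using that the circulants commute, this is \<open>2 c \<cdot> \<langle>A y, B y\<rangle>\<close>, a sum that
  telescopes over the periodic line. The last stage is pointwise a rotation in the coordinates
  \<open>(\<surd>\<epsilon> E, \<surd>\<mu> H)\<close>.
\<close>

section \<open>Cyclic index shifts and sums over a periodic line\<close>

lemma cyclic_pred_succ: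
  assumes "r < (m :: nat)"
  shows "((r + 1) mod m + m - 1) mod m = r" and "((r + m - 1) mod m + 1) mod m = r"
proof -
  show "((r + 1) mod m + m - 1) mod m = r"
    using assms by (cases "r + 1 = m") auto
  have "((r + m - 1) mod m + 1) mod m = (r + m - 1 + 1) mod m"
    by (rule mod_add_left_eq)
  \<comment> \<open>Since \<open>r < m\<close> forces \<open>m\<close> to be positive,
    \<open>+ 1\<close> undoes the truncated subtraction and \<open>r + m\<close> reduces to
    \<open>r\<close>, also at the wrap-around \<open>r = 0\<close>.\<close>
  also have "\<dots> = r"
    using assms by simp
  finally show "((r + m - 1) mod m + 1) mod m = r" .
qed

lemma sum_cyclic_succ:
  fixes f :: "nat \<Rightarrow> 'a :: comm_monoid_add"
  shows "(\<Sum>r<m. f ((r + 1) mod m)) = (\<Sum>r<m. f r)"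
  by (rule sum.reindex_bij_witness[of _ "\<lambda>r. (r + m - 1) mod m" "\<lambda>r. (r + 1) mod m"])
    (use cyclic_pred_succ[of _ m] in auto)

lemma sum_cyclic_pred:
  fixes f :: "nat \<Rightarrow> 'a :: comm_monoid_add"
  shows "(\<Sum>r<m. f ((r + m - 1) mod m)) = (\<Sum>r<m. f r)"
  by (rule sum.reindex_bij_witness[of _ "\<lambda>r. (r + 1) mod m" "\<lambda>r. (r + m - 1) mod m"])
    (use cyclic_pred_succ[of _ m] in auto)

section \<open>Circulant matrices, their block versions, and one midpoint step along a line\<close>

lemma circ_A_carrier [simp]: "circ_A m \<in> carrier_mat m m"
  by (simp add: circ_A_def)

lemma circ_B_carrier [simp]: "circ_B m \<in> carrier_mat m m"
  by (simp add: circ_B_def)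

lemma circ_A_mult_vec_carrier [simp]:
  "v \<in> carrier_vec m \<Longrightarrow> circ_A m *\<^sub>v v \<in> carrier_vec m"
  by (rule mult_mat_vec_carrier[OF circ_A_carrier])

lemma circ_B_mult_vec_carrier [simp]:
  "v \<in> carrier_vec m \<Longrightarrow> circ_B m *\<^sub>v v \<in> carrier_vec m"
  by (rule mult_mat_vec_carrier[OF circ_B_carrier])

lemma zero_mat_mult_vec:
  "v \<in> carrier_vec n \<Longrightarrow> 0\<^sub>m m n *\<^sub>v v = (0\<^sub>v m :: 'a :: semiring_0 vec)"
  by (intro eq_vecI) auto

lemma block_A_carrier [simp]: "block_A m \<in> carrier_mat (m + m) (m + m)"
  by (simp add: block_A_def)

lemma block_B_carrier [simp]: "block_B m \<in> carrier_mat (m + m) (m + m)"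
  by (simp add: block_B_def)

text \<open>Both matrices are combinations of the cyclic shift, its inverse and the identity, and
  these commute. Componentwise, each side becomes half of v(r+2) + 2 v(r+1) - 2 v(r-1) - v(r-2),
  with indices modulo \<open>m\<close>.\<close>

lemma circ_A_B_commute:
  assumes v: "v \<in> carrier_vec m"
  shows "circ_A m *\<^sub>v (circ_B m *\<^sub>v v) = circ_B m *\<^sub>v (circ_A m *\<^sub>v v)"
proof (rule eq_vecI)
  fix r assume "r < dim_vec (circ_B m *\<^sub>v (circ_A m *\<^sub>v v))"
  then have r: "r < m" by (simp add: circ_B_def)
  then have s: "(r + 1) mod m < m" and p: "(r + m - 1) mod m < m" by auto
  have A: "circ_A m *\<^sub>v v \<in> carrier_vec m" and B: "circ_B m *\<^sub>v v \<in> carrier_vec m"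
    using v by simp_all
  show "(circ_A m *\<^sub>v (circ_B m *\<^sub>v v)) $ r = (circ_B m *\<^sub>v (circ_A m *\<^sub>v v)) $ r"
    unfolding circ_A_mult_vec[OF B r] circ_B_mult_vec[OF A r]
      circ_A_mult_vec[OF v s] circ_A_mult_vec[OF v p]
      circ_B_mult_vec[OF v s] circ_B_mult_vec[OF v p] circ_B_mult_vec[OF v r]
      cyclic_pred_succ[OF r]
    by (simp add: field_simps)
qed (simp add: circ_A_def circ_B_def)

text \<open>In the symmetrised product the terms pairing r-1 with r+1 cancel, and what remains is a
  difference of shifted copies of the same functions. The sum is the inner product of
  \<open>block_A m\<close> and \<open>block_B m\<close> applied to the concatenation of
  \<open>y\<close> and \<open>z\<close>, the form in which the energy change appears.\<close>

lemma sum_circ_A_circ_B_skew: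
  assumes y: "y \<in> carrier_vec m" and z: "z \<in> carrier_vec m"
  shows "(\<Sum>r<m. (circ_A m *\<^sub>v y) $ r * (circ_B m *\<^sub>v z) $ r
      + (circ_A m *\<^sub>v z) $ r * (circ_B m *\<^sub>v y) $ r) = 0"
proof -
  define s where "s r = (r + 1) mod m" for r
  define p where "p r = (r + m - 1) mod m" for r
  \<comment> \<open>\<open>f\<close> collects the products at a single site and \<open>g\<close> the
    symmetrised products of neighbours. The former telescope over two sites, the latter over
    one.\<close>
  define f where "f r = y $ r * z $ r" for r
  define g where "g r = y $ r * z $ s r + z $ r * y $ s r" for r
  have "(\<Sum>r<m. (circ_A m *\<^sub>v y) $ r * (circ_B m *\<^sub>v z) $ r
      + (circ_A m *\<^sub>v z) $ r * (circ_B m *\<^sub>v y) $ r)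
      = (\<Sum>r<m. (f (s r) - f (p r)) + (g r - g (p r)))"
  proof (rule sum.cong[OF refl])
    fix r assume "r \<in> {..<m}"
    then have r: "r < m" by simp
    have sp: "s (p r) = r" using cyclic_pred_succ[OF r] by (simp add: s_def p_def)
    show "(circ_A m *\<^sub>v y) $ r * (circ_B m *\<^sub>v z) $ r + (circ_A m *\<^sub>v z) $ r * (circ_B m *\<^sub>v y) $ r
      = (f (s r) - f (p r)) + (g r - g (p r))"
      unfolding circ_A_mult_vec[OF y r] circ_A_mult_vec[OF z r] circ_B_mult_vec[OF y r]
        circ_B_mult_vec[OF z r] s_def[symmetric] p_def[symmetric] f_def g_def sp
      by (simp add: field_simps)
  qed
  \<comment> \<open>Cyclic reindexing gives the shifted and the unshifted sums the same value, so
    there are no boundary terms.\<close>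
  also have "\<dots> = 0"
    unfolding sum.distrib sum_subtractf s_def p_def sum_cyclic_succ sum_cyclic_pred by simp
  finally show ?thesis .
qed

lemma block_A_mult_append:
  assumes "y \<in> carrier_vec m" "z \<in> carrier_vec m"
  shows "block_A m *\<^sub>v (y @\<^sub>v z) = (circ_A m *\<^sub>v y) @\<^sub>v (circ_A m *\<^sub>v z)"
  unfolding block_A_def using assms
  by (subst four_block_mat_mult_vec[of _ m m _ m _ m]) (auto simp: zero_mat_mult_vec)

lemma block_B_mult_append:
  assumes "y \<in> carrier_vec m" "z \<in> carrier_vec m"
  shows "block_B m *\<^sub>v (y @\<^sub>v z) = (circ_B m *\<^sub>v z) @\<^sub>v (circ_B m *\<^sub>v y)"
  unfolding block_B_def using assms
  by (subst four_block_mat_mult_vec[of _ m m _ m _ m]) (auto simp: zero_mat_mult_vec)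

text \<open>\<open>mat_inv\<close> is meaningful only if \<open>mat_inverse\<close> returns
  \<open>Some\<close>. An inverse C of the circulant gives the block diagonal inverse diag(C, C),
  which rules out \<open>None\<close>; the properties of the returned matrix then follow.\<close>

lemma mat_inv_block_A:
  assumes "invertible_mat (circ_A m)"
  shows "mat_inv (block_A m) \<in> carrier_mat (m + m) (m + m)"
    and "block_A m * mat_inv (block_A m) = 1\<^sub>m (m + m)"
    and "mat_inv (block_A m) * block_A m = 1\<^sub>m (m + m)"
proof -
  obtain C where C: "circ_A m * C = 1\<^sub>m m" "C * circ_A m = 1\<^sub>m (dim_row C)"
    using assms by (auto simp: invertible_mat_def inverts_mat_def circ_A_def)
  \<comment> \<open>The shape of \<open>C\<close> is not part of invertibility; comparing the column
    counts in the two product identities yields it.\<close>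
  have "dim_row C = m" "dim_col C = m"
    using C[THEN arg_cong[of _ _ dim_col]] by (simp_all add: circ_A_def)
  then have Cm: "C \<in> carrier_mat m m" by auto
  define D where "D = four_block_mat C (0\<^sub>m m m) (0\<^sub>m m m) C"
  have D: "D \<in> carrier_mat (m + m) (m + m)" using Cm by (simp add: D_def)
  have id: "four_block_mat (1\<^sub>m m) (0\<^sub>m m m) (0\<^sub>m m m) (1\<^sub>m m) = (1\<^sub>m (m + m) :: real mat)"
    by (rule eq_matI) auto
  have "block_A m * D = 1\<^sub>m (m + m)"
    unfolding block_A_def D_def using C Cm
    by (subst mult_four_block_mat[of _ m m _ m _ m _ _ m _ m])
      (auto simp: id right_mult_zero_mat[OF circ_A_carrier] left_mult_zero_mat[OF Cm])
  moreover have "D * block_A m = 1\<^sub>m (m + m)"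
    unfolding block_A_def D_def using C Cm
    by (subst mult_four_block_mat[of _ m m _ m _ m _ _ m _ m])
      (auto simp: id left_mult_zero_mat[OF circ_A_carrier] right_mult_zero_mat[OF Cm])
  ultimately have "block_A m \<in> Units (ring_mat TYPE(real) (m + m) ())"
    using D by (auto simp: Units_def ring_mat_def)
  then obtain N where N: "mat_inverse (block_A m) = Some N"
    using mat_inverse(1)[OF block_A_carrier, where b = "()"] by (cases "mat_inverse (block_A m)") auto
  show "mat_inv (block_A m) \<in> carrier_mat (m + m) (m + m)"
    and "block_A m * mat_inv (block_A m) = 1\<^sub>m (m + m)"
    and "mat_inv (block_A m) * block_A m = 1\<^sub>m (m + m)"
    using mat_inverse(2)[OF block_A_carrier N] N by (auto simp: mat_inv_def)
qed

text \<open>The real coefficient \<open>c\<close> is arbitrary, so this one lemma covers all six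
  line updates: three directions, each with both signs.\<close>

lemma line_step_energy:
  assumes inv: "invertible_mat (circ_A m)" and step: "line_step \<epsilon> \<mu> m c u u' v v'"
  shows "(\<Sum>r<m. \<epsilon> * (u' r)\<^sup>2 + \<mu> * (v' r)\<^sup>2) = (\<Sum>r<m. \<epsilon> * (u r)\<^sup>2 + \<mu> * (v r)\<^sup>2)"
proof -
  define N where "N = mat_inv (block_A m)"
  note N = mat_inv_block_A[OF inv, folded N_def]
  define w1 where "w1 = vec m (\<lambda>r. (u' r + u r) / 2)"
  define w2 where "w2 = vec m (\<lambda>r. (v' r + v r) / 2)"
  have w: "w1 \<in> carrier_vec m" "w2 \<in> carrier_vec m" "w1 @\<^sub>v w2 \<in> carrier_vec (m + m)"
    by (auto simp: w1_def w2_def)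
  have "N *\<^sub>v (w1 @\<^sub>v w2) \<in> carrier_vec (m + m)"
    using N(1) w(3) by (rule mult_mat_vec_carrier)
  \<comment> \<open>The halves of the inverse applied to the midpoint serve as potentials: below,
    the midpoints become \<open>w1\<close> = A y and \<open>w2\<close> = A z, which removes the
    inverse from the inner product.\<close>
  then obtain y z where yz: "y \<in> carrier_vec m" "z \<in> carrier_vec m" "N *\<^sub>v (w1 @\<^sub>v w2) = y @\<^sub>v z"
    by (metis vec_first_carrier vec_last_carrier vec_first_last_append)
  have yz': "y @\<^sub>v z \<in> carrier_vec (m + m)" using yz by auto
  have carr: "circ_A m *\<^sub>v y \<in> carrier_vec m" "circ_A m *\<^sub>v z \<in> carrier_vec m"
    "circ_B m *\<^sub>v y \<in> carrier_vec m" "circ_B m *\<^sub>v z \<in> carrier_vec m"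
    using yz by simp_all
  have "w1 @\<^sub>v w2 = block_A m *\<^sub>v (N *\<^sub>v (w1 @\<^sub>v w2))"
    using N w by (simp flip: assoc_mult_mat_vec[OF block_A_carrier N(1) w(3)])
  also have "\<dots> = (circ_A m *\<^sub>v y) @\<^sub>v (circ_A m *\<^sub>v z)"
    using yz by (simp add: block_A_mult_append)
  finally have w_eq: "w1 @\<^sub>v w2 = (circ_A m *\<^sub>v y) @\<^sub>v (circ_A m *\<^sub>v z)" .
  then have w1: "w1 = circ_A m *\<^sub>v y" and w2: "w2 = circ_A m *\<^sub>v z"
    using append_vec_eq[OF w(1) carr(1)] by blast+
  \<comment> \<open>Commutation moves a factor \<open>block_A m\<close> to the front, where the
    inverse \<open>N\<close> cancels it.\<close>
  have BA: "block_B m *\<^sub>v (w1 @\<^sub>v w2) = block_A m *\<^sub>v (block_B m *\<^sub>v (y @\<^sub>v z))"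
    using yz carr by (simp add: w_eq block_A_mult_append block_B_mult_append circ_A_B_commute)
  have Byz: "block_B m *\<^sub>v (y @\<^sub>v z) \<in> carrier_vec (m + m)"
    using yz' by (rule mult_mat_vec_carrier[OF block_B_carrier])
  have "(N * block_B m) *\<^sub>v (w1 @\<^sub>v w2) = N *\<^sub>v (block_A m *\<^sub>v (block_B m *\<^sub>v (y @\<^sub>v z)))"
    using N w by (simp add: assoc_mult_mat_vec[OF N(1) block_B_carrier w(3)] BA)
  also have "\<dots> = block_B m *\<^sub>v (y @\<^sub>v z)"
    using N Byz by (simp flip: assoc_mult_mat_vec[OF N(1) block_A_carrier Byz])
  also have "\<dots> = (circ_B m *\<^sub>v z) @\<^sub>v (circ_B m *\<^sub>v y)"
    using yz by (simp add: block_B_mult_append)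
  finally have "vec m (\<lambda>r. \<epsilon> * (u' r - u r)) @\<^sub>v vec m (\<lambda>r. \<mu> * (v' r - v r))
      = c \<cdot>\<^sub>v ((circ_B m *\<^sub>v z) @\<^sub>v (circ_B m *\<^sub>v y))"
    using step unfolding line_step_def N_def w1_def w2_def by simp
  also have "\<dots> = (c \<cdot>\<^sub>v (circ_B m *\<^sub>v z)) @\<^sub>v (c \<cdot>\<^sub>v (circ_B m *\<^sub>v y))"
    using carr by (intro eq_vecI) auto
  finally have "vec m (\<lambda>r. \<epsilon> * (u' r - u r)) = c \<cdot>\<^sub>v (circ_B m *\<^sub>v z)"
    and "vec m (\<lambda>r. \<mu> * (v' r - v r)) = c \<cdot>\<^sub>v (circ_B m *\<^sub>v y)"
    using append_vec_eq[OF vec_carrier smult_carrier_vec[THEN iffD2, OF carr(4)]] by blast+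
  then have du: "\<epsilon> * (u' r - u r) = c * (circ_B m *\<^sub>v z) $ r"
    and dv: "\<mu> * (v' r - v r) = c * (circ_B m *\<^sub>v y) $ r" if "r < m" for r
    using that carr by (metis index_vec index_smult_vec(1) carrier_vecD)+
  have "(\<Sum>r<m. \<epsilon> * (u' r)\<^sup>2 + \<mu> * (v' r)\<^sup>2) - (\<Sum>r<m. \<epsilon> * (u r)\<^sup>2 + \<mu> * (v r)\<^sup>2)
      = (\<Sum>r<m. 2 * c * ((circ_A m *\<^sub>v y) $ r * (circ_B m *\<^sub>v z) $ r
          + (circ_A m *\<^sub>v z) $ r * (circ_B m *\<^sub>v y) $ r))"
    unfolding sum_subtractf[symmetric]
  proof (rule sum.cong[OF refl])
    fix r assume "r \<in> {..<m}"
    then have r: "r < m" by simp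
    have a: "(circ_A m *\<^sub>v y) $ r = (u' r + u r) / 2" "(circ_A m *\<^sub>v z) $ r = (v' r + v r) / 2"
      using r by (simp_all add: w1[symmetric] w2[symmetric] w1_def w2_def)
    \<comment> \<open>Difference of squares: each energy increment is twice the midpoint times the
      weighted increment prescribed by the scheme.\<close>
    have "\<epsilon> * (u' r)\<^sup>2 + \<mu> * (v' r)\<^sup>2 - (\<epsilon> * (u r)\<^sup>2 + \<mu> * (v r)\<^sup>2)
        = (u' r + u r) * (\<epsilon> * (u' r - u r)) + (v' r + v r) * (\<mu> * (v' r - v r))"
      by (simp add: power2_eq_square algebra_simps)
    then show "\<epsilon> * (u' r)\<^sup>2 + \<mu> * (v' r)\<^sup>2 - (\<epsilon> * (u r)\<^sup>2 + \<mu> * (v r)\<^sup>2)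
        = 2 * c * ((circ_A m *\<^sub>v y) $ r * (circ_B m *\<^sub>v z) $ r
          + (circ_A m *\<^sub>v z) $ r * (circ_B m *\<^sub>v y) $ r)"
      unfolding du[OF r] dv[OF r] a by (simp add: field_simps)
  qed
  also have "\<dots> = 0"
    unfolding sum_distrib_left[symmetric] sum_circ_A_circ_B_skew[OF yz(1,2)] by simp
  finally show ?thesis by simp
qed

section \<open>Discrete energy and its conservation by the three deterministic stages\<close>

definition energy_density :: "real \<Rightarrow> real \<Rightarrow> grid_field \<Rightarrow> grid_field \<Rightarrow> grid_fun" where
  "energy_density \<epsilon> \<mu> E H i j k =
     \<epsilon> * ((E 1 i j k)\<^sup>2 + (E 2 i j k)\<^sup>2 + (E 3 i j k)\<^sup>2)
     + \<mu> * ((H 1 i j k)\<^sup>2 + (H 2 i j k)\<^sup>2 + (H 3 i j k)\<^sup>2)"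

definition grid_energy :: "real \<Rightarrow> real \<Rightarrow> nat \<Rightarrow> nat \<Rightarrow> nat \<Rightarrow> grid_field \<Rightarrow> grid_field \<Rightarrow> real" where
  "grid_energy \<epsilon> \<mu> I J K E H = (\<Sum>i<I. \<Sum>j<J. \<Sum>k<K. energy_density \<epsilon> \<mu> E H i j k)"

text \<open>Links the norms to a plain sum that can be regrouped along grid lines. Positive mesh
  sizes make the radicands nonnegative, so squaring removes the roots, and the cell volume factors
  out.\<close>

lemma field_norm_energy:
  assumes "hx > 0" "hy > 0" "hz > 0"
  shows "\<epsilon> * (field_norm hx hy hz I J K E)\<^sup>2 + \<mu> * (field_norm hx hy hz I J K H)\<^sup>2
    = hx * hy * hz * grid_energy \<epsilon> \<mu> I J K E H"
proof -
  have l2: "(l2_norm hx hy hz I J K u)\<^sup>2 = hx * hy * hz * (\<Sum>i<I. \<Sum>j<J. \<Sum>k<K. (u i j k)\<^sup>2)" for u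
    unfolding l2_norm_def using assms by (subst real_sqrt_pow2) (auto intro!: mult_nonneg_nonneg sum_nonneg)
  have fn: "(field_norm hx hy hz I J K F)\<^sup>2 = hx * hy * hz * (\<Sum>i<I. \<Sum>j<J. \<Sum>k<K.
      (F 1 i j k)\<^sup>2 + (F 2 i j k)\<^sup>2 + (F 3 i j k)\<^sup>2)" for F
    \<comment> \<open>The outer root is removed first, while the terms under it are still visibly
      squares.\<close>
    by (simp add: field_norm_def) (simp add: l2 sum.distrib distrib_left)
  show ?thesis
    unfolding fn grid_energy_def energy_density_def
    by (simp add: sum.distrib distrib_left sum_distrib_left mult_ac)
qed

text \<open>On each line in the x direction the energy splits into three independent pairs: (E1, H1)
  is frozen, while (E2, H3) and (E3, H2) each make a midpoint step with opposite signs of the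
  coefficient.\<close>

lemma stage1_energy:
  assumes "invertible_mat (circ_A I)" and st: "stage1 \<epsilon> \<mu> \<tau> hx I J K E H E' H'"
  shows "grid_energy \<epsilon> \<mu> I J K E' H' = grid_energy \<epsilon> \<mu> I J K E H"
proof -
  have *: "(\<Sum>i<I. energy_density \<epsilon> \<mu> E' H' i j k) = (\<Sum>i<I. energy_density \<epsilon> \<mu> E H i j k)"
    if jk: "j < J" "k < K" for j k
  proof -
    have "(\<Sum>i<I. energy_density \<epsilon> \<mu> F G i j k) = (\<Sum>i<I. \<epsilon> * (F 1 i j k)\<^sup>2 + \<mu> * (G 1 i j k)\<^sup>2)
        + (\<Sum>i<I. \<epsilon> * (F 2 i j k)\<^sup>2 + \<mu> * (G 3 i j k)\<^sup>2)
        + (\<Sum>i<I. \<epsilon> * (F 3 i j k)\<^sup>2 + \<mu> * (G 2 i j k)\<^sup>2)" for F G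
      by (simp add: energy_density_def sum.distrib distrib_left)
    moreover have "(\<Sum>i<I. \<epsilon> * (E' 1 i j k)\<^sup>2 + \<mu> * (H' 1 i j k)\<^sup>2)
        = (\<Sum>i<I. \<epsilon> * (E 1 i j k)\<^sup>2 + \<mu> * (H 1 i j k)\<^sup>2)"
      using st jk by (intro sum.cong) (auto simp: stage1_def)
    moreover have "(\<Sum>i<I. \<epsilon> * (E' 2 i j k)\<^sup>2 + \<mu> * (H' 3 i j k)\<^sup>2)
        = (\<Sum>i<I. \<epsilon> * (E 2 i j k)\<^sup>2 + \<mu> * (H 3 i j k)\<^sup>2)"
      \<comment> \<open>The coefficient occurs only in the premise, not in the goal, so it is
        supplied explicitly.\<close>
      by (rule line_step_energy[OF assms(1), of _ _ "- (\<tau> / hx)"])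
        (use st jk in \<open>simp add: stage1_def\<close>)
    moreover have "(\<Sum>i<I. \<epsilon> * (E' 3 i j k)\<^sup>2 + \<mu> * (H' 2 i j k)\<^sup>2)
        = (\<Sum>i<I. \<epsilon> * (E 3 i j k)\<^sup>2 + \<mu> * (H 2 i j k)\<^sup>2)"
      by (rule line_step_energy[OF assms(1), of _ _ "\<tau> / hx"])
        (use st jk in \<open>simp add: stage1_def\<close>)
    ultimately show ?thesis by simp
  qed
  \<comment> \<open>Two exchanges of sums make the x direction innermost, so that line conservation
    applies.\<close>
  have "grid_energy \<epsilon> \<mu> I J K F G = (\<Sum>j<J. \<Sum>k<K. \<Sum>i<I. energy_density \<epsilon> \<mu> F G i j k)" for F G
    unfolding grid_energy_def by (subst sum.swap) (rule sum.cong[OF refl], rule sum.swap)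
  then show ?thesis using * by simp
qed

text \<open>The same splitting in the y direction: (E2, H2) is frozen, and (E3, H1) and (E1, H3)
  make the midpoint steps.\<close>

lemma stage2_energy:
  assumes "invertible_mat (circ_A J)" and st: "stage2 \<epsilon> \<mu> \<tau> hy I J K E H E' H'"
  shows "grid_energy \<epsilon> \<mu> I J K E' H' = grid_energy \<epsilon> \<mu> I J K E H"
proof -
  have *: "(\<Sum>j<J. energy_density \<epsilon> \<mu> E' H' i j k) = (\<Sum>j<J. energy_density \<epsilon> \<mu> E H i j k)"
    if ik: "i < I" "k < K" for i k
  proof -
    have "(\<Sum>j<J. energy_density \<epsilon> \<mu> F G i j k) = (\<Sum>j<J. \<epsilon> * (F 2 i j k)\<^sup>2 + \<mu> * (G 2 i j k)\<^sup>2)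
        + (\<Sum>j<J. \<epsilon> * (F 3 i j k)\<^sup>2 + \<mu> * (G 1 i j k)\<^sup>2)
        + (\<Sum>j<J. \<epsilon> * (F 1 i j k)\<^sup>2 + \<mu> * (G 3 i j k)\<^sup>2)" for F G
      by (simp add: energy_density_def sum.distrib distrib_left)
    moreover have "(\<Sum>j<J. \<epsilon> * (E' 2 i j k)\<^sup>2 + \<mu> * (H' 2 i j k)\<^sup>2)
        = (\<Sum>j<J. \<epsilon> * (E 2 i j k)\<^sup>2 + \<mu> * (H 2 i j k)\<^sup>2)"
      using st ik by (intro sum.cong) (auto simp: stage2_def)
    moreover have "(\<Sum>j<J. \<epsilon> * (E' 3 i j k)\<^sup>2 + \<mu> * (H' 1 i j k)\<^sup>2)
        = (\<Sum>j<J. \<epsilon> * (E 3 i j k)\<^sup>2 + \<mu> * (H 1 i j k)\<^sup>2)"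
      by (rule line_step_energy[OF assms(1), of _ _ "- (\<tau> / hy)"])
        (use st ik in \<open>simp add: stage2_def\<close>)
    moreover have "(\<Sum>j<J. \<epsilon> * (E' 1 i j k)\<^sup>2 + \<mu> * (H' 3 i j k)\<^sup>2)
        = (\<Sum>j<J. \<epsilon> * (E 1 i j k)\<^sup>2 + \<mu> * (H 3 i j k)\<^sup>2)"
      by (rule line_step_energy[OF assms(1), of _ _ "\<tau> / hy"])
        (use st ik in \<open>simp add: stage2_def\<close>)
    ultimately show ?thesis by simp
  qed
  have "grid_energy \<epsilon> \<mu> I J K F G = (\<Sum>i<I. \<Sum>k<K. \<Sum>j<J. energy_density \<epsilon> \<mu> F G i j k)" for F G
    unfolding grid_energy_def by (rule sum.cong[OF refl], rule sum.swap)
  then show ?thesis using * by simp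
qed

text \<open>The same splitting in the z direction, with (E3, H3) frozen; the z sum is already
  innermost in \<open>grid_energy\<close>.\<close>

lemma stage3_energy:
  assumes "invertible_mat (circ_A K)" and st: "stage3 \<epsilon> \<mu> \<tau> hz I J K E H E' H'"
  shows "grid_energy \<epsilon> \<mu> I J K E' H' = grid_energy \<epsilon> \<mu> I J K E H"
proof -
  have *: "(\<Sum>k<K. energy_density \<epsilon> \<mu> E' H' i j k) = (\<Sum>k<K. energy_density \<epsilon> \<mu> E H i j k)"
    if ij: "i < I" "j < J" for i j
  proof -
    have "(\<Sum>k<K. energy_density \<epsilon> \<mu> F G i j k) = (\<Sum>k<K. \<epsilon> * (F 3 i j k)\<^sup>2 + \<mu> * (G 3 i j k)\<^sup>2)
        + (\<Sum>k<K. \<epsilon> * (F 1 i j k)\<^sup>2 + \<mu> * (G 2 i j k)\<^sup>2)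
        + (\<Sum>k<K. \<epsilon> * (F 2 i j k)\<^sup>2 + \<mu> * (G 1 i j k)\<^sup>2)" for F G
      by (simp add: energy_density_def sum.distrib distrib_left)
    moreover have "(\<Sum>k<K. \<epsilon> * (E' 3 i j k)\<^sup>2 + \<mu> * (H' 3 i j k)\<^sup>2)
        = (\<Sum>k<K. \<epsilon> * (E 3 i j k)\<^sup>2 + \<mu> * (H 3 i j k)\<^sup>2)"
      using st ij by (intro sum.cong) (auto simp: stage3_def)
    moreover have "(\<Sum>k<K. \<epsilon> * (E' 1 i j k)\<^sup>2 + \<mu> * (H' 2 i j k)\<^sup>2)
        = (\<Sum>k<K. \<epsilon> * (E 1 i j k)\<^sup>2 + \<mu> * (H 2 i j k)\<^sup>2)"
      by (rule line_step_energy[OF assms(1), of _ _ "- (\<tau> / hz)"])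
        (use st ij in \<open>simp add: stage3_def\<close>)
    moreover have "(\<Sum>k<K. \<epsilon> * (E' 2 i j k)\<^sup>2 + \<mu> * (H' 1 i j k)\<^sup>2)
        = (\<Sum>k<K. \<epsilon> * (E 2 i j k)\<^sup>2 + \<mu> * (H 1 i j k)\<^sup>2)"
      by (rule line_step_energy[OF assms(1), of _ _ "\<tau> / hz"])
        (use st ij in \<open>simp add: stage3_def\<close>)
    ultimately show ?thesis by simp
  qed
  then show ?thesis by (simp add: grid_energy_def)
qed

section \<open>Conservation by the pointwise stochastic flow\<close>

lemma rotation_energy:
  fixes \<epsilon> \<mu> e h x :: real
  assumes "\<epsilon> > 0" "\<mu> > 0"
  shows "\<epsilon> * (cos x * e - sqrt \<mu> / sqrt \<epsilon> * sin x * h)\<^sup>2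
      + \<mu> * (sqrt \<epsilon> / sqrt \<mu> * sin x * e + cos x * h)\<^sup>2 = \<epsilon> * e\<^sup>2 + \<mu> * h\<^sup>2"
proof -
  define a where "a = sqrt \<epsilon>"
  define b where "b = sqrt \<mu>"
  have ab: "a \<noteq> 0" "b \<noteq> 0" "\<epsilon> = a\<^sup>2" "\<mu> = b\<^sup>2" using assms by (auto simp: a_def b_def)
  have expand: "(a * c * e - b * s * h)\<^sup>2 + (a * s * e + b * c * h)\<^sup>2
      = (a\<^sup>2 * e\<^sup>2 + b\<^sup>2 * h\<^sup>2) * (s\<^sup>2 + c\<^sup>2)" for c s
    by (simp add: power2_eq_square algebra_simps)
  \<comment> \<open>Pulling the weights into the squares clears the quotients and leaves the plain
    rotation of (a e, b h) by the angle \<open>x\<close>.\<close>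
  have "a\<^sup>2 * (cos x * e - b / a * sin x * h)\<^sup>2 + b\<^sup>2 * (a / b * sin x * e + cos x * h)\<^sup>2
      = (a * cos x * e - b * sin x * h)\<^sup>2 + (a * sin x * e + b * cos x * h)\<^sup>2"
    unfolding power_mult_distrib[symmetric] right_diff_distrib distrib_left
    using ab(1,2) by (simp add: mult_ac)
  also have "\<dots> = (a\<^sup>2 * e\<^sup>2 + b\<^sup>2 * h\<^sup>2) * ((sin x)\<^sup>2 + (cos x)\<^sup>2)"
    by (rule expand)
  also have "\<dots> = a\<^sup>2 * e\<^sup>2 + b\<^sup>2 * h\<^sup>2" by simp
  finally show ?thesis
    unfolding a_def[symmetric] b_def[symmetric] unfolding ab(3,4) .
qed

text \<open>The closed form of the exponential has scalar multiples of the identity as blocks, so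
  the flow acts on the three component pairs separately and in the same way.\<close>

lemma stoch_flow_mult_append:
  fixes \<epsilon> \<mu> lam t :: real
  assumes pos: "\<epsilon> > 0" "\<mu> > 0" and carr: "e \<in> carrier_vec 3" "h \<in> carrier_vec 3"
  defines "x \<equiv> lam / sqrt (\<epsilon> * \<mu>) * t"
  shows "stoch_flow \<epsilon> \<mu> lam t *\<^sub>v (e @\<^sub>v h)
    = (cos x \<cdot>\<^sub>v e - (sqrt \<mu> / sqrt \<epsilon> * sin x) \<cdot>\<^sub>v h)
      @\<^sub>v ((sqrt \<epsilon> / sqrt \<mu> * sin x) \<cdot>\<^sub>v e + cos x \<cdot>\<^sub>v h)"
proof -
  have s: "(a \<cdot>\<^sub>m 1\<^sub>m 3) *\<^sub>v w = a \<cdot>\<^sub>v w" if "w \<in> carrier_vec 3" for a :: real and w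
    using that by (intro eq_vecI) auto
  show ?thesis
    unfolding stoch_flow_closed_form[OF pos] x_def[symmetric]
    using carr by (subst four_block_mat_mult_vec[of _ 3 3 _ 3 _ 3]) (auto simp: s)
qed

lemma stage4_energy:
  assumes pos: "\<epsilon> > 0" "\<mu> > 0" and st: "stage4 \<epsilon> \<mu> lam I J K dW E H E' H'"
  shows "grid_energy \<epsilon> \<mu> I J K E' H' = grid_energy \<epsilon> \<mu> I J K E H"
proof -
  have "energy_density \<epsilon> \<mu> E' H' i j k = energy_density \<epsilon> \<mu> E H i j k"
    if "i < I" "j < J" "k < K" for i j k
  proof -
    define x where "x = lam / sqrt (\<epsilon> * \<mu>) * dW i j k"
    define p where "p = sqrt \<mu> / sqrt \<epsilon> * sin x"
    define q where "q = sqrt \<epsilon> / sqrt \<mu> * sin x"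
    let ?e = "\<lambda>F. vec_of_list [F 1 i j k, F 2 i j k, F 3 i j k] :: real vec"
    have carr: "?e F \<in> carrier_vec 3" for F :: grid_field
      by (rule carrier_vecI) simp
    have "?e E' @\<^sub>v ?e H' = (cos x \<cdot>\<^sub>v ?e E - p \<cdot>\<^sub>v ?e H) @\<^sub>v (q \<cdot>\<^sub>v ?e E + cos x \<cdot>\<^sub>v ?e H)"
      using st that stoch_flow_mult_append[OF pos carr carr]
      unfolding stage4_def point_vec_def x_def p_def q_def by simp
    moreover have "cos x \<cdot>\<^sub>v ?e E - p \<cdot>\<^sub>v ?e H \<in> carrier_vec 3"
      using carr by simp
    ultimately have eq: "?e E' = cos x \<cdot>\<^sub>v ?e E - p \<cdot>\<^sub>v ?e H" "?e H' = q \<cdot>\<^sub>v ?e E + cos x \<cdot>\<^sub>v ?e H"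
      using append_vec_eq[OF carr] by blast+
    \<comment> \<open>List positions 0, 1, 2 hold the components 1, 2, 3; each pair of electric and
      magnetic components then satisfies the hypothesis-free identity of a weighted rotation by
      \<open>x\<close>.\<close>
    have "E' 1 i j k = cos x * E 1 i j k - p * H 1 i j k" "H' 1 i j k = q * E 1 i j k + cos x * H 1 i j k"
      using eq[THEN arg_cong[of _ _ "\<lambda>w. w $ 0"]] by auto
    moreover have "E' 2 i j k = cos x * E 2 i j k - p * H 2 i j k" "H' 2 i j k = q * E 2 i j k + cos x * H 2 i j k"
      using eq[THEN arg_cong[of _ _ "\<lambda>w. w $ 1"]] by auto
    moreover have "E' 3 i j k = cos x * E 3 i j k - p * H 3 i j k" "H' 3 i j k = q * E 3 i j k + cos x * H 3 i j k"
      using eq[THEN arg_cong[of _ _ "\<lambda>w. w $ 2"]] by (auto simp: numeral_2_eq_2)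
    ultimately show ?thesis
      using rotation_energy[OF pos, of x "E 1 i j k" "H 1 i j k"]
        rotation_energy[OF pos, of x "E 2 i j k" "H 2 i j k"]
        rotation_energy[OF pos, of x "E 3 i j k" "H 3 i j k"]
      unfolding energy_density_def p_def q_def by (simp add: distrib_left)
  qed
  then show ?thesis by (simp add: grid_energy_def)
qed

section \<open>Composition of the four stages and the almost sure identity\<close>

lemma splitting_step_energy:
  assumes "\<epsilon> > 0" "\<mu> > 0"
    and "invertible_mat (circ_A I)" "invertible_mat (circ_A J)" "invertible_mat (circ_A K)"
    and "splitting_step \<epsilon> \<mu> lam \<tau> hx hy hz I J K dW E H E' H'"
  shows "grid_energy \<epsilon> \<mu> I J K E' H' = grid_energy \<epsilon> \<mu> I J K E H"
  using assms stage1_energy stage2_energy stage3_energy stage4_energy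
  unfolding splitting_step_def by metis

theorem theorem4p2:
  fixes M :: "'w measure"
    and \<epsilon> \<mu> lam \<tau> hx hy hz :: real
    and I J K :: nat
    and Q :: "nat \<times> nat \<times> nat \<Rightarrow> nat \<times> nat \<times> nat \<Rightarrow> real"
    and W :: "real \<Rightarrow> nat \<times> nat \<times> nat \<Rightarrow> 'w \<Rightarrow> real"
    and E H :: "nat \<Rightarrow> 'w \<Rightarrow> grid_field"
  assumes "\<epsilon> > 0" and "\<mu> > 0" and "\<tau> > 0" and "hx > 0" and "hy > 0" and "hz > 0"
    and "I \<ge> 3" and "J \<ge> 3" and "K \<ge> 3"
    and "invertible_mat (circ_A I)" and "invertible_mat (circ_A J)" and "invertible_mat (circ_A K)"
    and "prob_space M"
    and "Q_wiener M (grid I J K) Q W"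
    and "\<And>n. random_grid_field M I J K (E n)" and "\<And>n. random_grid_field M I J K (H n)"
    and "\<And>n. AE \<omega> in M. splitting_step \<epsilon> \<mu> lam \<tau> hx hy hz I J K (noise_increment \<tau> W n \<omega>)
           (E n \<omega>) (H n \<omega>) (E (Suc n) \<omega>) (H (Suc n) \<omega>)"
  shows "\<forall>n. AE \<omega> in M.
           \<epsilon> * (field_norm hx hy hz I J K (E (Suc n) \<omega>))\<^sup>2
             + \<mu> * (field_norm hx hy hz I J K (H (Suc n) \<omega>))\<^sup>2
           = \<epsilon> * (field_norm hx hy hz I J K (E n \<omega>))\<^sup>2
             + \<mu> * (field_norm hx hy hz I J K (H n \<omega>))\<^sup>2"
proof
  fix n
  show "AE \<omega> in M. \<epsilon> * (field_norm hx hy hz I J K (E (Suc n) \<omega>))\<^sup>2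
      + \<mu> * (field_norm hx hy hz I J K (H (Suc n) \<omega>))\<^sup>2
      = \<epsilon> * (field_norm hx hy hz I J K (E n \<omega>))\<^sup>2 + \<mu> * (field_norm hx hy hz I J K (H n \<omega>))\<^sup>2"
    using assms(17)[of n]
  proof (rule AE_mp, intro AE_I2 impI)
    \<comment> \<open>Conservation is a pathwise statement: it holds at every outcome at which the
      scheme holds for this \<open>n\<close>, so the exceptional null set is inherited from the
      scheme.\<close>
    fix \<omega>
    assume "splitting_step \<epsilon> \<mu> lam \<tau> hx hy hz I J K (noise_increment \<tau> W n \<omega>)
      (E n \<omega>) (H n \<omega>) (E (Suc n) \<omega>) (H (Suc n) \<omega>)"
    then show "\<epsilon> * (field_norm hx hy hz I J K (E (Suc n) \<omega>))\<^sup>2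
      + \<mu> * (field_norm hx hy hz I J K (H (Suc n) \<omega>))\<^sup>2
      = \<epsilon> * (field_norm hx hy hz I J K (E n \<omega>))\<^sup>2 + \<mu> * (field_norm hx hy hz I J K (H n \<omega>))\<^sup>2"
      unfolding field_norm_energy[OF assms(4,5,6)]
      by (simp add: splitting_step_energy[OF assms(1,2,10,11,12)])
  qed
qed

end
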